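(* Let $c$ be an integer. If a graph $G$ has no cycle of length greater than $c$, then \[\mathrm{HG}(G) < \left( \frac{64}{25} \right)^{2^{\lfloor \frac{1}{2}c^2 \rfloor - 1}} + \frac{1}{2}.\]
   Context: All graphs are finite, simple and undirected. For a vertex $v$ of a graph $G$, $N(v)$ denotes its set of neighbors, and $[q]=\{1,\dots,q\}$. The length of a cycle is its number of edges. The right-hand side is $(64/25)$ raised to the power $2^{\lfloor c^2/2\rfloor - 1}$, plus $1/2$. Hat guessing game on $G$ with $q$ colors: a guessing strategy is a family of functions $\Gamma = \{\Gamma_v : v\in V(G)\}$ with $\Gamma_v : [q]^{N(v)} \to [q]$. A hat assignment is a (not necessarily proper) coloring $\varphi : V(G)\to[q]$. The player at $v$ guesses correctly if $\Gamma_v(\varphi|_{N(v)}) = \varphi(v)$. The strategy $\Gamma$ is winning for the players if for every hat assignment $\varphi$ at least one vertex $v$ guesses correctly. The hat guessing number $\mathrm{HG}(G)$ is the maximum integer $q$ such that the players have a winning guessing strategy on $G$ with $q$ colors. *)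

theory Defs
  imports Complex_Main "HOL-Library.FuncSet" "Graph_Theory.Digraph" "Graph_Theory.Arc_Walk"
begin

text \<open>
  Finite simple undirected graphs are the symmetric digraphs without loops and multiple arcs of
  the locale \<^locale>\<open>graph\<close>.
\<close>

definition neighbors :: "('a, 'b) pre_digraph \<Rightarrow> 'a \<Rightarrow> 'a set" where
  "neighbors G v = {w \<in> verts G. v \<rightarrow>\<^bsub>G\<^esub> w}"

text \<open>
  In a symmetric digraph an edge traversed back and forth is a directed cycle with two arcs,
  which is not a cycle of the undirected graph. All other directed cycles have at least three
  arcs, and these are the cycles of the undirected graph, with the same length.
\<close>

definition undirected_cycle :: "('a, 'b) pre_digraph \<Rightarrow> 'b list \<Rightarrow> bool" where
  "undirected_cycle G p \<longleftrightarrow> pre_digraph.cycle G p \<and> 3 \<le> length p"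

definition hat_assignments :: "('a, 'b) pre_digraph \<Rightarrow> nat \<Rightarrow> ('a \<Rightarrow> nat) set" where
  "hat_assignments G q = verts G \<rightarrow>\<^sub>E {1..q}"

definition guessing_strategy ::
    "('a, 'b) pre_digraph \<Rightarrow> nat \<Rightarrow> ('a \<Rightarrow> ('a \<Rightarrow> nat) \<Rightarrow> nat) \<Rightarrow> bool" where
  "guessing_strategy G q \<Gamma> \<longleftrightarrow>
     (\<forall>v\<in>verts G. \<Gamma> v \<in> (neighbors G v \<rightarrow>\<^sub>E {1..q}) \<rightarrow> {1..q})"

definition guesses_correctly ::
    "('a, 'b) pre_digraph \<Rightarrow> ('a \<Rightarrow> ('a \<Rightarrow> nat) \<Rightarrow> nat) \<Rightarrow> ('a \<Rightarrow> nat) \<Rightarrow> 'a \<Rightarrow> bool" where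
  "guesses_correctly G \<Gamma> \<phi> v \<longleftrightarrow> \<Gamma> v (restrict \<phi> (neighbors G v)) = \<phi> v"

definition winning_strategy ::
    "('a, 'b) pre_digraph \<Rightarrow> nat \<Rightarrow> ('a \<Rightarrow> ('a \<Rightarrow> nat) \<Rightarrow> nat) \<Rightarrow> bool" where
  "winning_strategy G q \<Gamma> \<longleftrightarrow> guessing_strategy G q \<Gamma> \<and>
     (\<forall>\<phi>\<in>hat_assignments G q. \<exists>v\<in>verts G. guesses_correctly G \<Gamma> \<phi> v)"

text \<open>
  On a nonempty set of natural numbers that is bounded above, \<^const>\<open>Sup\<close> is the
  maximum; the lemma \<open>hat_guessing_number_maximum\<close> below shows that this is the case
  for every graph with a vertex. The graph without vertices has no winning strategy for any
  number of colors, and its hat guessing number is \<open>Sup {} = 0\<close> by convention.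
\<close>

definition hat_guessing_number :: "('a, 'b) pre_digraph \<Rightarrow> nat" where
  "hat_guessing_number G = Sup {q. \<exists>\<Gamma>. winning_strategy G q \<Gamma>}"

lemma winning_strategy_le_card:
  assumes G: "graph G" and win: "winning_strategy G q \<Gamma>"
  shows "q \<le> card (verts G)"
proof (cases "q = 0")
  case False
  interpret graph G by (fact G)
  let ?V = "verts G"
  let ?C = "\<lambda>v. {\<phi> \<in> hat_assignments G q. guesses_correctly G \<Gamma> \<phi> v}"
  have card_C: "card (?C v) \<le> q ^ (card ?V - 1)" if v: "v \<in> ?V" for v
  proof -
    have nbr: "neighbors G v \<subseteq> ?V - {v}"
      using adj_not_same by (auto simp: neighbors_def)
    have "inj_on (\<lambda>\<phi>. restrict \<phi> (?V - {v})) (?C v)"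
    proof (rule inj_onI)
      fix \<phi> \<psi>
      assume \<phi>: "\<phi> \<in> ?C v" and \<psi>: "\<psi> \<in> ?C v"
        and eq: "restrict \<phi> (?V - {v}) = restrict \<psi> (?V - {v})"
      have off: "\<phi> x = \<psi> x" if "x \<in> ?V - {v}" for x
        using fun_cong[OF eq, of x] that by simp
      have "restrict \<phi> (neighbors G v) = restrict \<psi> (neighbors G v)"
        using nbr off by (intro restrict_ext) blast
      then have at: "\<phi> v = \<psi> v"
        using \<phi> \<psi> by (auto simp: guesses_correctly_def)
      show "\<phi> = \<psi>"
      proof (rule PiE_ext)
        show "\<phi> \<in> ?V \<rightarrow>\<^sub>E {1..q}" "\<psi> \<in> ?V \<rightarrow>\<^sub>E {1..q}"
          using \<phi> \<psi> by (auto simp: hat_assignments_def)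
        show "\<phi> x = \<psi> x" if "x \<in> ?V" for x
          using off at that by (cases "x = v") auto
      qed
    qed
    moreover have "(\<lambda>\<phi>. restrict \<phi> (?V - {v})) ` ?C v \<subseteq> (?V - {v}) \<rightarrow>\<^sub>E {1..q}"
      by (rule image_subsetI) (auto simp: hat_assignments_def restrict_PiE_iff dest: PiE_mem)
    ultimately have "card (?C v) \<le> card ((?V - {v}) \<rightarrow>\<^sub>E {1..q})"
      by (intro card_inj_on_le) (auto intro: finite_PiE)
    then show ?thesis
      using v by (simp add: card_PiE)
  qed
  have "(\<lambda>x\<in>?V. 1) \<in> hat_assignments G q"
    using False by (auto simp: hat_assignments_def)
  then have "?V \<noteq> {}"
    using win by (auto simp: winning_strategy_def)
  then have pos: "0 < card ?V"
    by (simp add: card_gt_0_iff)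
  have "hat_assignments G q = (\<Union>v\<in>?V. ?C v)"
    using win by (auto simp: winning_strategy_def)
  then have "card (hat_assignments G q) = card (\<Union>v\<in>?V. ?C v)"
    by (rule arg_cong)
  also have "\<dots> \<le> (\<Sum>v\<in>?V. card (?C v))"
    by (rule card_UN_le[OF finite_verts])
  also have "\<dots> \<le> card ?V * q ^ (card ?V - 1)"
    using sum_bounded_above[OF card_C] by simp
  finally have "q ^ card ?V \<le> card ?V * q ^ (card ?V - 1)"
    by (simp add: hat_assignments_def card_PiE)
  then have "q * q ^ (card ?V - 1) \<le> card ?V * q ^ (card ?V - 1)"
    using power_minus_mult[OF pos, of q] by (simp add: mult.commute)
  then show ?thesis
    using False by simp
qed simp

lemma winning_strategy_one:
  assumes "verts G \<noteq> {}"
  shows "winning_strategy G 1 (\<lambda>_ _. 1)"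
  using assms
  by (auto simp: winning_strategy_def guessing_strategy_def guesses_correctly_def
      hat_assignments_def PiE_iff)

lemma hat_guessing_number_maximum:
  assumes "graph G" and "verts G \<noteq> {}"
  shows "\<exists>\<Gamma>. winning_strategy G (hat_guessing_number G) \<Gamma>"
    and "winning_strategy G q \<Gamma> \<Longrightarrow> q \<le> hat_guessing_number G"
proof -
  let ?Q = "{q. \<exists>\<Gamma>. winning_strategy G q \<Gamma>}"
  have fin: "finite ?Q"
    using winning_strategy_le_card[OF assms(1)] by (auto simp: finite_nat_set_iff_bounded_le)
  have ne: "?Q \<noteq> {}"
    using winning_strategy_one[OF assms(2)] by blast
  have "hat_guessing_number G = Max ?Q"
    using ne unfolding hat_guessing_number_def Sup_nat_def by (simp only: if_False)
  with Max_in[OF fin ne] Max_ge[OF fin, of q]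
  show "\<exists>\<Gamma>. winning_strategy G (hat_guessing_number G) \<Gamma>"
    and "winning_strategy G q \<Gamma> \<Longrightarrow> q \<le> hat_guessing_number G"
    by auto
qed

end

theory Submission
  imports Defs
begin

text \<open>
  Give every vertex \<open>s\<close> guesses instead of one. If the color of a vertex \<open>v\<close> is only known to lie
  in a set of \<open>s + 1\<close> colors, every other vertex can be granted its guesses for all these colors at
  once, at most \<open>s (s + 1)\<close> in total. If all of them still fail, one of the \<open>s + 1\<close> colors makes
  \<open>v\<close> fail too. Hence the players lose on \<open>G\<close> with \<open>s\<close> guesses if they lose on \<open>G - v\<close> with
  \<open>s (s + 1)\<close> guesses. The same argument is compatible with gluing at cut vertices, because at most
  \<open>s\<close> colors of a cut vertex fail to extend to the part behind it, so it is enough to bound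
  the number of removal steps in each block \<open>B\<close>.

  Depth-first search exhausts \<open>B\<close> in as many steps as a path in \<open>B\<close> can have vertices. A path \<open>P\<close>
  in \<open>B\<close> has at most \<open>c (c - 1) / 2\<close> edges: its ends lie on a common cycle, hence at distance at
  most \<open>c / 2\<close>, and a shortest path between them advances by at most \<open>c - 1\<close> along \<open>P\<close> whenever it
  leaves \<open>P\<close> and returns, since such a detour closes a cycle with the skipped part of \<open>P\<close>.
\<close>

text \<open>These are the terms of Sylvester's sequence 2, 3, 7, 43, \<dots> minus 1.\<close>

primrec sylvester :: "nat \<Rightarrow> nat" where
  "sylvester 0 = 1"
| "sylvester (Suc k) = sylvester k * Suc (sylvester k)"

lemma sylvester_mono: "k \<le> n \<Longrightarrow> sylvester k \<le> sylvester n"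
  by (rule lift_Suc_mono_le) simp_all

lemma sylvester_pos: "1 \<le> sylvester k"
  using sylvester_mono[of 0 k] by simp

text \<open>The offset makes the induction close: squaring \<open>t + 3 / 4\<close> gives
  \<open>t * (t + 1)\<close> plus \<open>t / 2 + 9 / 16\<close>, which is at least
  \<open>3 / 4\<close> since \<open>t\<close> is at least 1. With offset 1/2 the square would leave
  only 1/4.\<close>

lemma sylvester_bound: "real (sylvester d) + 3 / 4 \<le> (64 / 25) ^ 2 ^ d"
proof (induction d)
  case (Suc d)
  define t X where "t = real (sylvester d)" and "X = (64 / 25 :: real) ^ 2 ^ d"
  have t: "1 \<le> t" "t + 3 / 4 \<le> X"
    using Suc sylvester_pos[of d] by (simp_all add: t_def X_def)
  have "(t + 3 / 4) * (t + 3 / 4) \<le> X * X" using t by (intro mult_mono) auto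
  then have "t * (1 + t) + 3 / 4 \<le> X * X" using t(1) by (simp add: algebra_simps)
  moreover have "X * X = (64 / 25) ^ 2 ^ Suc d"
    unfolding X_def by (simp only: power_add[symmetric] power_Suc mult_2)
  ultimately show ?case by (simp add: t_def distrib_left)
qed simp

section \<open>The game with several guesses\<close>

locale simple_graph =
  fixes E :: "'a \<Rightarrow> 'a \<Rightarrow> bool"
  assumes sym: "E x y \<Longrightarrow> E y x"
    and irrefl: "\<not> E x x"
begin

text \<open>Guesses are functions of total colorings, and locality is a congruence condition on the
  neighbors inside \<open>S\<close>. Colorings of different parts can then be spliced pointwise
  without restricting them.\<close>

definition strategy :: "nat \<Rightarrow> 'a set \<Rightarrow> ('a \<Rightarrow> ('a \<Rightarrow> nat) \<Rightarrow> nat set) \<Rightarrow> bool" where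
  "strategy s S \<Gamma> \<longleftrightarrow> (\<forall>v\<in>S. (\<forall>\<phi>. finite (\<Gamma> v \<phi>) \<and> card (\<Gamma> v \<phi>) \<le> s) \<and>
     (\<forall>\<phi> \<psi>. (\<forall>w\<in>S. E v w \<longrightarrow> \<phi> w = \<psi> w) \<longrightarrow> \<Gamma> v \<phi> = \<Gamma> v \<psi>))"

definition loses :: "nat \<Rightarrow> nat \<Rightarrow> 'a set \<Rightarrow> bool" where
  "loses q s S \<longleftrightarrow> (\<forall>\<Gamma>. strategy s S \<Gamma> \<longrightarrow>
     (\<exists>\<phi>. range \<phi> \<subseteq> {1..q} \<and> (\<forall>v\<in>S. \<phi> v \<notin> \<Gamma> v \<phi>)))"

text \<open>
  The coloring \<open>x\<close> of the neighbors of \<open>v\<close> may not depend on the color in \<open>A\<close>, so that the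
  guesses of \<open>v\<close> miss some color of \<open>A\<close>. The colors of all other vertices may depend on it.
\<close>

definition rooted_loses :: "nat \<Rightarrow> nat \<Rightarrow> 'a set \<Rightarrow> 'a \<Rightarrow> bool" where
  "rooted_loses q s S v \<longleftrightarrow> (\<forall>\<Gamma> A. strategy s S \<Gamma> \<longrightarrow> A \<subseteq> {1..q} \<longrightarrow> card A = Suc s \<longrightarrow>
     (\<exists>x \<phi>. range x \<subseteq> {1..q} \<and> (\<forall>a\<in>A. range (\<phi> a) \<subseteq> {1..q} \<and> \<phi> a v = a \<and>
       (\<forall>w\<in>S. E v w \<longrightarrow> \<phi> a w = x w) \<and> (\<forall>w\<in>S. w \<noteq> v \<longrightarrow> \<phi> a w \<notin> \<Gamma> w (\<phi> a)))))"

section \<open>Strategies, rooted colorings and the removal of a vertex\<close>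

lemma strategy_finite:
  "strategy s S \<Gamma> \<Longrightarrow> v \<in> S \<Longrightarrow> finite (\<Gamma> v \<phi>)"
  and strategy_card: "strategy s S \<Gamma> \<Longrightarrow> v \<in> S \<Longrightarrow> card (\<Gamma> v \<phi>) \<le> s"
  unfolding strategy_def by blast+

lemma strategy_cong:
  assumes "strategy s S \<Gamma>" "v \<in> S" "\<And>w. w \<in> S \<Longrightarrow> E v w \<Longrightarrow> \<phi> w = \<psi> w"
  shows "\<Gamma> v \<phi> = \<Gamma> v \<psi>"
  using assms unfolding strategy_def by blast

lemma strategyI:
  assumes "\<And>v \<phi>. v \<in> S \<Longrightarrow> finite (\<Gamma> v \<phi>)" "\<And>v \<phi>. v \<in> S \<Longrightarrow> card (\<Gamma> v \<phi>) \<le> s"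
    and "\<And>v \<phi> \<psi>. v \<in> S \<Longrightarrow> (\<And>w. w \<in> S \<Longrightarrow> E v w \<Longrightarrow> \<phi> w = \<psi> w) \<Longrightarrow> \<Gamma> v \<phi> = \<Gamma> v \<psi>"
  shows "strategy s S \<Gamma>"
  unfolding strategy_def
proof (intro ballI conjI allI impI)
  show "\<Gamma> v \<phi> = \<Gamma> v \<psi>" if "v \<in> S" "\<forall>w\<in>S. E v w \<longrightarrow> \<phi> w = \<psi> w" for v \<phi> \<psi>
    by (rule assms(3)) (use that in auto)
qed (fact assms)+

lemma strategy_subset:
  assumes "strategy s S \<Gamma>" "T \<subseteq> S" "\<And>v w. v \<in> T \<Longrightarrow> w \<in> S \<Longrightarrow> E v w \<Longrightarrow> w \<in> T"
  shows "strategy s T \<Gamma>"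
proof (rule strategyI)
  fix v and \<phi> \<psi> :: "'a \<Rightarrow> nat" assume "v \<in> T" and eq: "\<And>w. w \<in> T \<Longrightarrow> E v w \<Longrightarrow> \<phi> w = \<psi> w"
  with assms(2,3) show "\<Gamma> v \<phi> = \<Gamma> v \<psi>"
    by (intro strategy_cong[OF assms(1)]) auto
qed (use assms(2) strategy_finite[OF assms(1)] strategy_card[OF assms(1)] in auto)

lemma loses_empty: "1 \<le> q \<Longrightarrow> loses q s {}"
  unfolding loses_def by (auto intro!: exI[of _ "\<lambda>_. 1"])

lemma losesE:
  assumes "loses q s S" "strategy s S \<Gamma>"
  obtains \<phi> where "range \<phi> \<subseteq> {1..q}" "\<And>v. v \<in> S \<Longrightarrow> \<phi> v \<notin> \<Gamma> v \<phi>"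
  using assms(1)[unfolded loses_def, rule_format, OF assms(2)] that by blast

lemma rooted_losesE:
  assumes "rooted_loses q s S v" "strategy s S \<Gamma>" "A \<subseteq> {1..q}" "card A = Suc s"
  obtains x \<phi> where "range x \<subseteq> {1..q}"
    "\<And>a. a \<in> A \<Longrightarrow> range (\<phi> a) \<subseteq> {1..q}" "\<And>a. a \<in> A \<Longrightarrow> \<phi> a v = a"
    "\<And>a w. a \<in> A \<Longrightarrow> w \<in> S \<Longrightarrow> E v w \<Longrightarrow> \<phi> a w = x w"
    "\<And>a w. a \<in> A \<Longrightarrow> w \<in> S \<Longrightarrow> w \<noteq> v \<Longrightarrow> \<phi> a w \<notin> \<Gamma> w (\<phi> a)"
proof -
  from assms(1)[unfolded rooted_loses_def, rule_format, OF assms(2-4)]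
  obtain x \<phi> where "range x \<subseteq> {1..q}" and "\<forall>a\<in>A. range (\<phi> a) \<subseteq> {1..q} \<and> \<phi> a v = a \<and>
      (\<forall>w\<in>S. E v w \<longrightarrow> \<phi> a w = x w) \<and> (\<forall>w\<in>S. w \<noteq> v \<longrightarrow> \<phi> a w \<notin> \<Gamma> w (\<phi> a))"
    by (elim exE conjE)
  then show ?thesis by (intro that[of x \<phi>]) blast+
qed

text \<open>All the colorings \<open>\<phi> a\<close> agree with \<open>x\<close> around
  \<open>v\<close>, so \<open>v\<close> makes the same at most \<open>s\<close> guesses in each of
  them. These cannot cover the \<open>s + 1\<close> colors of \<open>A\<close>.\<close>

lemma rooted_loses_color:
  assumes "rooted_loses q s S v" "v \<in> S" "strategy s S \<Gamma>" "A \<subseteq> {1..q}" "card A = Suc s"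
  obtains \<phi> where "range \<phi> \<subseteq> {1..q}" "\<phi> v \<in> A" "\<And>w. w \<in> S \<Longrightarrow> \<phi> w \<notin> \<Gamma> w \<phi>"
proof -
  from assms(1,3-5) obtain x \<phi> where *: "\<And>a. a \<in> A \<Longrightarrow> range (\<phi> a) \<subseteq> {1..q}"
    "\<And>a. a \<in> A \<Longrightarrow> \<phi> a v = a" "\<And>a w. a \<in> A \<Longrightarrow> w \<in> S \<Longrightarrow> E v w \<Longrightarrow> \<phi> a w = x w"
    "\<And>a w. a \<in> A \<Longrightarrow> w \<in> S \<Longrightarrow> w \<noteq> v \<Longrightarrow> \<phi> a w \<notin> \<Gamma> w (\<phi> a)"
    by (rule rooted_losesE) blast
  have "\<not> A \<subseteq> \<Gamma> v x"
    using card_mono[OF strategy_finite[OF assms(3,2), of x], of A]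
      strategy_card[OF assms(3,2), of x] assms(5) by auto
  then obtain a where a: "a \<in> A" "a \<notin> \<Gamma> v x" by blast
  have "\<Gamma> v (\<phi> a) = \<Gamma> v x"
    using *(3)[OF a(1)] by (intro strategy_cong[OF assms(3,2)])
  with a * show ?thesis by (intro that[of "\<phi> a"]) metis+
qed

lemma rooted_loses_imp_loses:
  assumes "rooted_loses q s S v" "v \<in> S" "s < q"
  shows "loses q s S"
  unfolding loses_def
proof (intro allI impI)
  fix \<Gamma> assume \<Gamma>: "strategy s S \<Gamma>"
  have "{1..Suc s} \<subseteq> {1..q}" "card {1..Suc s} = Suc s" using assms(3) by auto
  from rooted_loses_color[OF assms(1,2) \<Gamma> this]
  show "\<exists>\<phi>. range \<phi> \<subseteq> {1..q} \<and> (\<forall>v\<in>S. \<phi> v \<notin> \<Gamma> v \<phi>)" by metis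
qed

text \<open>Every other vertex receives the union of its guesses over all colors of \<open>A\<close>
  at \<open>v\<close>. A coloring that escapes these unions can be given any color of
  \<open>A\<close> at \<open>v\<close>, so it serves as \<open>x\<close> and, updated at
  \<open>v\<close>, as every \<open>\<phi> a\<close>.\<close>

lemma rooted_loses_remove_vertex:
  assumes "loses q (s * Suc s) (S - {v})"
  shows "rooted_loses q s S v"
  unfolding rooted_loses_def
proof (intro allI impI)
  fix \<Gamma> A assume \<Gamma>: "strategy s S \<Gamma>" and A: "A \<subseteq> {1..q}" "card A = Suc s"
  have finA: "finite A" using A(1) finite_subset by blast
  define \<Gamma>' where "\<Gamma>' w \<phi> = (\<Union>a\<in>A. \<Gamma> w (\<phi>(v := a)))" for w \<phi>
  have "strategy (s * Suc s) (S - {v}) \<Gamma>'"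
  proof (rule strategyI)
    fix w \<phi> assume w: "w \<in> S - {v}"
    then show "finite (\<Gamma>' w \<phi>)"
      using finA strategy_finite[OF \<Gamma>] by (auto simp: \<Gamma>'_def)
    have "card (\<Gamma>' w \<phi>) \<le> (\<Sum>a\<in>A. card (\<Gamma> w (\<phi>(v := a))))"
      unfolding \<Gamma>'_def by (rule card_UN_le[OF finA])
    also have "\<dots> \<le> (\<Sum>a\<in>A. s)"
      using w by (intro sum_mono strategy_card[OF \<Gamma>]) auto
    finally show "card (\<Gamma>' w \<phi>) \<le> s * Suc s" using A by (simp add: mult.commute)
  next
    fix w and \<phi> \<psi> :: "'a \<Rightarrow> nat" assume w: "w \<in> S - {v}" and "\<And>u. u \<in> S - {v} \<Longrightarrow> E w u \<Longrightarrow> \<phi> u = \<psi> u"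
    then have "\<Gamma> w (\<phi>(v := a)) = \<Gamma> w (\<psi>(v := a))" for a
      by (intro strategy_cong[OF \<Gamma>]) auto
    then show "\<Gamma>' w \<phi> = \<Gamma>' w \<psi>" by (simp add: \<Gamma>'_def)
  qed
  with assms obtain \<phi> where \<phi>: "range \<phi> \<subseteq> {1..q}" "\<And>w. w \<in> S - {v} \<Longrightarrow> \<phi> w \<notin> \<Gamma>' w \<phi>"
    by (rule losesE) blast
  then show "\<exists>x \<phi>. range x \<subseteq> {1..q} \<and> (\<forall>a\<in>A. range (\<phi> a) \<subseteq> {1..q} \<and> \<phi> a v = a \<and>
       (\<forall>w\<in>S. E v w \<longrightarrow> \<phi> a w = x w) \<and> (\<forall>w\<in>S. w \<noteq> v \<longrightarrow> \<phi> a w \<notin> \<Gamma> w (\<phi> a)))"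
    using A(1) irrefl
    by (intro exI[of _ \<phi>] exI[of _ "\<lambda>a. \<phi>(v := a)"]) (auto simp: \<Gamma>'_def)
qed

lemma loses_remove_vertex:
  assumes "loses q (s * Suc s) (S - {v})" "v \<in> S" "s < q"
  shows "loses q s S"
  using rooted_loses_remove_vertex[OF assms(1)] assms(2,3) by (rule rooted_loses_imp_loses)

subsection \<open>Gluing at cut vertices\<close>

definition separation :: "'a set \<Rightarrow> 'a set \<Rightarrow> bool" where
  "separation S1 S2 \<longleftrightarrow> (\<forall>x\<in>S1 - S2. \<forall>y\<in>S2 - S1. \<not> E x y)"

lemma separation_sym: "separation S1 S2 \<Longrightarrow> separation S2 S1"
  using sym unfolding separation_def by blast

text \<open>A vertex of \<open>S1 - S2\<close> has no neighbor in \<open>S2 - S1\<close>, so only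
  the colors on \<open>S1\<close> can influence it.\<close>

lemma strategy_separation:
  assumes "strategy s (S1 \<union> S2) \<Gamma>" "separation S1 S2" "v \<in> S1 - S2"
    "\<And>w. w \<in> S1 \<Longrightarrow> E v w \<Longrightarrow> \<phi> w = \<psi> w"
  shows "\<Gamma> v \<phi> = \<Gamma> v \<psi>"
  using assms(2-4) by (intro strategy_cong[OF assms(1)]) (auto simp: separation_def)

lemma range_glue:
  fixes f g :: "'a \<Rightarrow> nat"
  shows "range f \<subseteq> R \<Longrightarrow> range g \<subseteq> R \<Longrightarrow> range (\<lambda>z. if z \<in> S then f z else g z) \<subseteq> R"
  by auto

text \<open>For each \<open>a\<close> the two colorings agree at the common vertex \<open>v\<close>,
  where both have color \<open>a\<close>. Every other vertex sees only its own side, and the fixed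
  colors around \<open>v\<close> are read off \<open>x\<close> on one side and \<open>y\<close> on
  the other.\<close>

lemma rooted_loses_glue_root:
  assumes sep: "separation S1 S2" and inter: "S1 \<inter> S2 = {v}"
    and r1: "rooted_loses q s S1 v" and r2: "rooted_loses q s S2 v"
  shows "rooted_loses q s (S1 \<union> S2) v"
  unfolding rooted_loses_def
proof (intro allI impI)
  fix \<Gamma> A assume \<Gamma>: "strategy s (S1 \<union> S2) \<Gamma>" and A: "A \<subseteq> {1..q}" "card A = Suc s"
  note sep' = separation_sym[OF sep]
  have \<Gamma>': "strategy s (S2 \<union> S1) \<Gamma>" using \<Gamma> by (simp add: Un_commute)
  \<comment> \<open>The vertex \<open>v\<close> may see both sides, so its guesses are not local to
    either of them. They are switched off, which is harmless because a rooted coloring need not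
    escape the guesses at its root.\<close>
  define \<Gamma>' where "\<Gamma>' w = (if w = v then (\<lambda>_. {}) else \<Gamma> w)" for w
  have st1: "strategy s S1 \<Gamma>'"
  proof (rule strategyI)
    fix u and \<phi> \<psi> :: "'a \<Rightarrow> nat"
    assume u: "u \<in> S1" and eq: "\<And>z. z \<in> S1 \<Longrightarrow> E u z \<Longrightarrow> \<phi> z = \<psi> z"
    show "\<Gamma>' u \<phi> = \<Gamma>' u \<psi>"
    proof (cases "u = v")
      case False
      then have "u \<in> S1 - S2" using u inter by blast
      from strategy_separation[OF \<Gamma> sep this eq] show ?thesis by (simp add: \<Gamma>'_def)
    qed (simp add: \<Gamma>'_def)
  qed (use strategy_finite[OF \<Gamma>] strategy_card[OF \<Gamma>] in \<open>auto simp: \<Gamma>'_def\<close>)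
  have st2: "strategy s S2 \<Gamma>'"
  proof (rule strategyI)
    fix u and \<phi> \<psi> :: "'a \<Rightarrow> nat"
    assume u: "u \<in> S2" and eq: "\<And>z. z \<in> S2 \<Longrightarrow> E u z \<Longrightarrow> \<phi> z = \<psi> z"
    show "\<Gamma>' u \<phi> = \<Gamma>' u \<psi>"
    proof (cases "u = v")
      case False
      then have "u \<in> S2 - S1" using u inter by blast
      from strategy_separation[OF \<Gamma>' sep' this eq] show ?thesis by (simp add: \<Gamma>'_def)
    qed (simp add: \<Gamma>'_def)
  qed (use strategy_finite[OF \<Gamma>] strategy_card[OF \<Gamma>] in \<open>auto simp: \<Gamma>'_def\<close>)
  from r1 st1 A obtain x \<phi> where x: "range x \<subseteq> {1..q}" "\<And>a. a \<in> A \<Longrightarrow> range (\<phi> a) \<subseteq> {1..q}"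
    "\<And>a. a \<in> A \<Longrightarrow> \<phi> a v = a" "\<And>a w. a \<in> A \<Longrightarrow> w \<in> S1 \<Longrightarrow> E v w \<Longrightarrow> \<phi> a w = x w"
    "\<And>a w. a \<in> A \<Longrightarrow> w \<in> S1 \<Longrightarrow> w \<noteq> v \<Longrightarrow> \<phi> a w \<notin> \<Gamma>' w (\<phi> a)"
    by (rule rooted_losesE) blast
  from r2 st2 A obtain y \<psi> where y: "range y \<subseteq> {1..q}" "\<And>a. a \<in> A \<Longrightarrow> range (\<psi> a) \<subseteq> {1..q}"
    "\<And>a. a \<in> A \<Longrightarrow> \<psi> a v = a" "\<And>a w. a \<in> A \<Longrightarrow> w \<in> S2 \<Longrightarrow> E v w \<Longrightarrow> \<psi> a w = y w"
    "\<And>a w. a \<in> A \<Longrightarrow> w \<in> S2 \<Longrightarrow> w \<noteq> v \<Longrightarrow> \<psi> a w \<notin> \<Gamma>' w (\<psi> a)"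
    by (rule rooted_losesE) blast
  define z where "z u = (if u \<in> S1 then x u else y u)" for u
  define \<chi> where "\<chi> a u = (if u \<in> S1 then \<phi> a u else \<psi> a u)" for a u
  have "\<chi> a w \<notin> \<Gamma> w (\<chi> a)" if a: "a \<in> A" and w: "w \<in> S1 \<union> S2" "w \<noteq> v" for a w
  proof (cases "w \<in> S1")
    case True
    then have w1: "w \<in> S1 - S2" using w inter by blast
    have "\<Gamma> w (\<chi> a) = \<Gamma> w (\<phi> a)"
      by (rule strategy_separation[OF \<Gamma> sep w1]) (simp add: \<chi>_def)
    then show ?thesis using x(5)[OF a True w(2)] True w by (simp add: \<chi>_def \<Gamma>'_def)
  next
    case False
    then have w1: "w \<in> S2 - S1" using w by blast
    have "\<chi> a u = \<psi> a u" if "u \<in> S2" for u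
      using that inter x(3)[OF a] y(3)[OF a] by (cases "u = v") (auto simp: \<chi>_def)
    then have "\<Gamma> w (\<chi> a) = \<Gamma> w (\<psi> a)"
      by (intro strategy_separation[OF \<Gamma>' sep' w1])
    then show ?thesis using y(5)[OF a _ w(2)] w1 w by (simp add: \<chi>_def \<Gamma>'_def)
  qed
  moreover have "range z \<subseteq> {1..q}" unfolding z_def by (rule range_glue[OF x(1) y(1)])
  moreover have "range (\<chi> a) \<subseteq> {1..q}" if "a \<in> A" for a
    unfolding \<chi>_def by (rule range_glue[OF x(2) y(2)]) (use that in auto)
  moreover have "\<chi> a v = a" if "a \<in> A" for a using x(3)[OF that] y(3)[OF that] by (simp add: \<chi>_def)
  moreover have "\<chi> a w = z w" if "a \<in> A" "w \<in> S1 \<union> S2" "E v w" for a w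
    using that x(4) y(4) by (auto simp: \<chi>_def z_def)
  ultimately show "\<exists>x \<phi>. range x \<subseteq> {1..q} \<and> (\<forall>a\<in>A. range (\<phi> a) \<subseteq> {1..q} \<and> \<phi> a v = a \<and>
       (\<forall>w\<in>S1 \<union> S2. E v w \<longrightarrow> \<phi> a w = x w) \<and> (\<forall>w\<in>S1 \<union> S2. w \<noteq> v \<longrightarrow> \<phi> a w \<notin> \<Gamma> w (\<phi> a)))"
    by (intro exI[of _ z] exI[of _ \<chi>]) simp
qed

text \<open>No edge joins the two sides, so a single escaping coloring of \<open>S2\<close> can be
  added to the colorings of \<open>S1\<close> for every \<open>a\<close>.\<close>

lemma rooted_loses_glue_disjoint:
  assumes sep: "separation S1 S2" and inter: "S1 \<inter> S2 = {}" and v: "v \<in> S1"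
    and r1: "rooted_loses q s S1 v" and l2: "loses q s S2"
  shows "rooted_loses q s (S1 \<union> S2) v"
  unfolding rooted_loses_def
proof (intro allI impI)
  fix \<Gamma> A assume \<Gamma>: "strategy s (S1 \<union> S2) \<Gamma>" and A: "A \<subseteq> {1..q}" "card A = Suc s"
  note sep' = separation_sym[OF sep]
  have \<Gamma>': "strategy s (S2 \<union> S1) \<Gamma>" using \<Gamma> by (simp add: Un_commute)
  have st: "strategy s S1 \<Gamma>" "strategy s S2 \<Gamma>"
    using sep sep' inter by (auto intro!: strategy_subset[OF \<Gamma>] simp: separation_def)
  from r1 st(1) A obtain x \<phi> where x: "range x \<subseteq> {1..q}" "\<And>a. a \<in> A \<Longrightarrow> range (\<phi> a) \<subseteq> {1..q}"
    "\<And>a. a \<in> A \<Longrightarrow> \<phi> a v = a" "\<And>a w. a \<in> A \<Longrightarrow> w \<in> S1 \<Longrightarrow> E v w \<Longrightarrow> \<phi> a w = x w"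
    "\<And>a w. a \<in> A \<Longrightarrow> w \<in> S1 \<Longrightarrow> w \<noteq> v \<Longrightarrow> \<phi> a w \<notin> \<Gamma> w (\<phi> a)"
    by (rule rooted_losesE) blast
  from l2 st(2) obtain \<psi> where \<psi>: "range \<psi> \<subseteq> {1..q}" "\<And>w. w \<in> S2 \<Longrightarrow> \<psi> w \<notin> \<Gamma> w \<psi>"
    by (rule losesE) blast
  define \<chi> where "\<chi> a u = (if u \<in> S1 then \<phi> a u else \<psi> u)" for a u
  have "\<chi> a w \<notin> \<Gamma> w (\<chi> a)" if a: "a \<in> A" and w: "w \<in> S1 \<union> S2" "w \<noteq> v" for a w
  proof (cases "w \<in> S1")
    case True
    then have "\<Gamma> w (\<chi> a) = \<Gamma> w (\<phi> a)"
      using inter by (intro strategy_separation[OF \<Gamma> sep]) (auto simp: \<chi>_def)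
    then show ?thesis using x(5)[OF a True w(2)] True by (simp add: \<chi>_def)
  next
    case False
    then have "\<Gamma> w (\<chi> a) = \<Gamma> w \<psi>"
      using inter w by (intro strategy_separation[OF \<Gamma>' sep']) (auto simp: \<chi>_def)
    then show ?thesis using \<psi>(2)[of w] False w by (simp add: \<chi>_def)
  qed
  moreover have "range (\<chi> a) \<subseteq> {1..q}" if "a \<in> A" for a
    unfolding \<chi>_def by (rule range_glue[OF x(2)[OF that] \<psi>(1)])
  moreover have "\<chi> a v = a" if "a \<in> A" for a using x(3)[OF that] v by (simp add: \<chi>_def)
  moreover have "\<chi> a w = x w" if "a \<in> A" "w \<in> S1 \<union> S2" "E v w" for a w
  proof -
    have "w \<in> S1" using sep inter that v unfolding separation_def by blast
    then show ?thesis using that x(4) by (simp add: \<chi>_def)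
  qed
  ultimately show "\<exists>x \<phi>. range x \<subseteq> {1..q} \<and> (\<forall>a\<in>A. range (\<phi> a) \<subseteq> {1..q} \<and> \<phi> a v = a \<and>
       (\<forall>w\<in>S1 \<union> S2. E v w \<longrightarrow> \<phi> a w = x w) \<and> (\<forall>w\<in>S1 \<union> S2. w \<noteq> v \<longrightarrow> \<phi> a w \<notin> \<Gamma> w (\<phi> a)))"
    using x(1) by (intro exI[of _ x] exI[of _ \<chi>]) simp
qed

text \<open>
  At most \<open>s\<close> colors of \<open>w\<close> cannot be extended to \<open>S2\<close>. In the game on \<open>S1\<close> these colors
  become the guesses of \<open>w\<close>.
\<close>

lemma rooted_loses_glue_away:
  assumes sep: "separation S1 S2" and inter: "S1 \<inter> S2 = {w}" and v: "v \<in> S1" "v \<noteq> w"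
    and r1: "rooted_loses q s S1 v" and r2: "rooted_loses q s S2 w"
  shows "rooted_loses q s (S1 \<union> S2) v"
  unfolding rooted_loses_def
proof (intro allI impI)
  fix \<Gamma> A assume \<Gamma>: "strategy s (S1 \<union> S2) \<Gamma>" and A: "A \<subseteq> {1..q}" "card A = Suc s"
  note sep' = separation_sym[OF sep]
  have \<Gamma>': "strategy s (S2 \<union> S1) \<Gamma>" using \<Gamma> by (simp add: Un_commute)
  have w: "w \<in> S1" "w \<in> S2" using inter by auto
  \<comment> \<open>The vertex \<open>w\<close> sees both sides. Freezing the coloring \<phi> on
    \<open>S1\<close> turns its guesses into guesses in the game on \<open>S2\<close>.\<close>
  define \<Gamma>2 where
    "\<Gamma>2 \<phi> u \<psi> = (if u = w then \<Gamma> w (\<lambda>z. if z \<in> S1 then \<phi> z else \<psi> z) else \<Gamma> u \<psi>)" for \<phi> u \<psi>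
  define bad where
    "bad \<phi> = {a\<in>{1..q}. \<not> (\<exists>\<psi>. range \<psi> \<subseteq> {1..q} \<and> \<psi> w = a \<and> (\<forall>u\<in>S2. \<psi> u \<notin> \<Gamma>2 \<phi> u \<psi>))}" for \<phi>
  define \<Gamma>1 where "\<Gamma>1 u = (if u = w then bad else \<Gamma> u)" for u
  have st2: "strategy s S2 (\<Gamma>2 \<phi>)" for \<phi>
  proof (rule strategyI)
    fix u and \<psi> \<psi>' :: "'a \<Rightarrow> nat" assume u: "u \<in> S2" and eq: "\<And>z. z \<in> S2 \<Longrightarrow> E u z \<Longrightarrow> \<psi> z = \<psi>' z"
    show "\<Gamma>2 \<phi> u \<psi> = \<Gamma>2 \<phi> u \<psi>'"
    proof (cases "u = w")
      case True
      have "\<Gamma> w (\<lambda>z. if z \<in> S1 then \<phi> z else \<psi> z) = \<Gamma> w (\<lambda>z. if z \<in> S1 then \<phi> z else \<psi>' z)"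
        using w eq True by (intro strategy_cong[OF \<Gamma>]) auto
      then show ?thesis using True by (simp add: \<Gamma>2_def)
    next
      case False
      then have "u \<in> S2 - S1" using u inter by blast
      from strategy_separation[OF \<Gamma>' sep' this eq] show ?thesis using False by (simp add: \<Gamma>2_def)
    qed
  qed (use w strategy_finite[OF \<Gamma>] strategy_card[OF \<Gamma>] in \<open>auto simp: \<Gamma>2_def\<close>)
  \<comment> \<open>Among any \<open>s + 1\<close> colors, the rooted game on \<open>S2\<close>
    finds one for \<open>w\<close> that extends.\<close>
  have card_bad: "card (bad \<phi>) \<le> s" for \<phi>
  proof (rule ccontr)
    assume "\<not> card (bad \<phi>) \<le> s"
    then obtain B where B: "B \<subseteq> bad \<phi>" "card B = Suc s"
      by (meson not_less_eq_eq obtain_subset_with_card_n)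
    have "B \<subseteq> {1..q}" using B(1) by (auto simp: bad_def)
    from rooted_loses_color[OF r2 w(2) st2 this B(2)] obtain \<psi> where
      "range \<psi> \<subseteq> {1..q}" "\<psi> w \<in> B" "\<And>u. u \<in> S2 \<Longrightarrow> \<psi> u \<notin> \<Gamma>2 \<phi> u \<psi>" by metis
    moreover from this(2) have "\<psi> w \<in> bad \<phi>" using B(1) by blast
    ultimately show False by (auto simp: bad_def)
  qed
  have bad_cong: "bad \<phi> = bad \<phi>'" if "\<And>z. z \<in> S1 \<Longrightarrow> E w z \<Longrightarrow> \<phi> z = \<phi>' z" for \<phi> \<phi>'
  proof -
    have "\<Gamma> w (\<lambda>z. if z \<in> S1 then \<phi> z else \<psi> z) = \<Gamma> w (\<lambda>z. if z \<in> S1 then \<phi>' z else \<psi> z)" for \<psi>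
      using w that by (intro strategy_cong[OF \<Gamma>]) auto
    then have "\<Gamma>2 \<phi> = \<Gamma>2 \<phi>'" by (auto simp: \<Gamma>2_def fun_eq_iff)
    then show ?thesis by (simp add: bad_def)
  qed
  have st1: "strategy s S1 \<Gamma>1"
  proof (rule strategyI)
    fix u and \<phi> \<phi>' :: "'a \<Rightarrow> nat" assume u: "u \<in> S1" and eq: "\<And>z. z \<in> S1 \<Longrightarrow> E u z \<Longrightarrow> \<phi> z = \<phi>' z"
    show "\<Gamma>1 u \<phi> = \<Gamma>1 u \<phi>'"
    proof (cases "u = w")
      case True
      with bad_cong[of \<phi> \<phi>'] eq show ?thesis by (simp add: \<Gamma>1_def)
    next
      case False
      then have "u \<in> S1 - S2" using u inter by blast
      from strategy_separation[OF \<Gamma> sep this eq] show ?thesis using False by (simp add: \<Gamma>1_def)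
    qed
  qed (use strategy_finite[OF \<Gamma>] strategy_card[OF \<Gamma>] card_bad in \<open>auto simp: \<Gamma>1_def bad_def\<close>)
  from r1 st1 A obtain x \<phi> where x: "range x \<subseteq> {1..q}" "\<And>a. a \<in> A \<Longrightarrow> range (\<phi> a) \<subseteq> {1..q}"
    "\<And>a. a \<in> A \<Longrightarrow> \<phi> a v = a" "\<And>a w. a \<in> A \<Longrightarrow> w \<in> S1 \<Longrightarrow> E v w \<Longrightarrow> \<phi> a w = x w"
    "\<And>a w. a \<in> A \<Longrightarrow> w \<in> S1 \<Longrightarrow> w \<noteq> v \<Longrightarrow> \<phi> a w \<notin> \<Gamma>1 w (\<phi> a)"
    by (rule rooted_losesE) blast
  have "\<exists>\<psi>. range \<psi> \<subseteq> {1..q} \<and> \<psi> w = \<phi> a w \<and> (\<forall>u\<in>S2. \<psi> u \<notin> \<Gamma>2 (\<phi> a) u \<psi>)" if "a \<in> A" for a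
  proof -
    have "\<phi> a w \<in> {1..q}" using x(2)[OF that] by blast
    moreover have "\<phi> a w \<notin> bad (\<phi> a)" using x(5)[OF that w(1)] v by (simp add: \<Gamma>1_def)
    ultimately show ?thesis unfolding bad_def by blast
  qed
  then obtain \<psi> where \<psi>: "\<And>a. a \<in> A \<Longrightarrow> range (\<psi> a) \<subseteq> {1..q}" "\<And>a. a \<in> A \<Longrightarrow> \<psi> a w = \<phi> a w"
    "\<And>a u. a \<in> A \<Longrightarrow> u \<in> S2 \<Longrightarrow> \<psi> a u \<notin> \<Gamma>2 (\<phi> a) u (\<psi> a)" by metis
  define \<chi> where "\<chi> a u = (if u \<in> S1 then \<phi> a u else \<psi> a u)" for a u
  have "\<chi> a u \<notin> \<Gamma> u (\<chi> a)" if a: "a \<in> A" and u: "u \<in> S1 \<union> S2" "u \<noteq> v" for a u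
  proof -
    consider "u = w" | "u \<in> S1 - S2" | "u \<in> S2 - S1" using u inter by blast
    then show ?thesis
    proof cases
      case 1
      then have "\<Gamma> u (\<chi> a) = \<Gamma>2 (\<phi> a) u (\<psi> a)" by (simp add: \<Gamma>2_def \<chi>_def[abs_def])
      then show ?thesis using \<psi>(2)[OF a] \<psi>(3)[OF a w(2)] 1 w by (simp add: \<chi>_def)
    next
      case 2
      have "\<Gamma> u (\<chi> a) = \<Gamma> u (\<phi> a)"
        by (rule strategy_separation[OF \<Gamma> sep 2]) (simp add: \<chi>_def)
      then show ?thesis using x(5)[OF a _ u(2)] 2 w by (auto simp: \<chi>_def \<Gamma>1_def split: if_splits)
    next
      case 3
      have "\<chi> a z = \<psi> a z" if "z \<in> S2" for z
        using that inter \<psi>(2)[OF a] by (cases "z = w") (auto simp: \<chi>_def)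
      then have "\<Gamma> u (\<chi> a) = \<Gamma> u (\<psi> a)"
        by (intro strategy_separation[OF \<Gamma>' sep' 3])
      then show ?thesis using \<psi>(3)[OF a, of u] 3 w by (auto simp: \<chi>_def \<Gamma>2_def split: if_splits)
    qed
  qed
  moreover have "range (\<chi> a) \<subseteq> {1..q}" if "a \<in> A" for a
    unfolding \<chi>_def by (rule range_glue[OF x(2)[OF that] \<psi>(1)[OF that]])
  moreover have "\<chi> a v = a" if "a \<in> A" for a using x(3)[OF that] v by (simp add: \<chi>_def)
  moreover have "\<chi> a z = x z" if "a \<in> A" "z \<in> S1 \<union> S2" "E v z" for a z
  proof -
    have "z \<in> S1" using sep inter that v unfolding separation_def by blast
    then show ?thesis using that x(4) by (simp add: \<chi>_def)
  qed
  ultimately show "\<exists>x \<phi>. range x \<subseteq> {1..q} \<and> (\<forall>a\<in>A. range (\<phi> a) \<subseteq> {1..q} \<and> \<phi> a v = a \<and>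
       (\<forall>w\<in>S1 \<union> S2. E v w \<longrightarrow> \<phi> a w = x w) \<and> (\<forall>w\<in>S1 \<union> S2. w \<noteq> v \<longrightarrow> \<phi> a w \<notin> \<Gamma> w (\<phi> a)))"
    using x(1) by (intro exI[of _ x] exI[of _ \<chi>]) simp
qed

text \<open>For finite \<open>S\<close> this means connected and without a cut vertex, so it
  describes blocks that are not necessarily maximal. Single vertices and single edges are
  included.\<close>

definition inseparable :: "'a set \<Rightarrow> bool" where
  "inseparable S \<longleftrightarrow> (\<forall>S1 S2. S1 \<union> S2 = S \<longrightarrow> separation S1 S2 \<longrightarrow> card (S1 \<inter> S2) \<le> 1 \<longrightarrow>
     S1 = S \<or> S2 = S)"

text \<open>Induction on the size of \<open>S\<close> along separations of order at most one. If the
  separator is empty, equal to \<open>v\<close>, or another vertex, the pieces are joined by the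
  respective gluing lemma. In the last case \<open>S2\<close> is rooted at the separator, which is
  why the hypothesis ranges over all roots of a block.\<close>

lemma rooted_loses_if_blocks:
  assumes "finite S" "v \<in> S" "s < q"
    and "\<And>B u. B \<subseteq> S \<Longrightarrow> inseparable B \<Longrightarrow> u \<in> B \<Longrightarrow> rooted_loses q s B u"
  shows "rooted_loses q s S v"
  using assms(1,2,4)
proof (induction "card S" arbitrary: S v rule: less_induct)
  case less
  note IH = less(1) and blocks = less(4)
  show ?case
  proof (cases "inseparable S")
    case True
    with blocks less.prems show ?thesis by blast
  next
    case False
    have "\<exists>S1 S2. S1 \<union> S2 = S \<and> separation S1 S2 \<and> card (S1 \<inter> S2) \<le> 1 \<and> S1 \<noteq> S \<and> S2 \<noteq> S \<and> v \<in> S1"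
    proof -
      from False obtain S1 S2 where "S1 \<union> S2 = S" "separation S1 S2" "card (S1 \<inter> S2) \<le> 1"
        "S1 \<noteq> S" "S2 \<noteq> S" unfolding inseparable_def by blast
      then show ?thesis
        using less.prems(2) separation_sym[of S1 S2] by (cases "v \<in> S1") (metis, metis Un_iff Un_commute Int_commute)
    qed
    then obtain S1 S2 where S: "S1 \<union> S2 = S" "separation S1 S2" "card (S1 \<inter> S2) \<le> 1"
      "S1 \<noteq> S" "S2 \<noteq> S" "v \<in> S1" by blast
    have sub: "S1 \<subset> S" "S2 \<subset> S" using S by auto
    have fin: "finite S1" "finite S2" using sub less.prems(1) finite_subset by blast+
    have R: "rooted_loses q s T u" if "T = S1 \<or> T = S2" "u \<in> T" for T u
    proof (rule IH)
      show "card T < card S" using that sub less.prems(1) by (auto intro: psubset_card_mono)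
      show "finite T" using that fin by blast
      show "rooted_loses q s B w" if "B \<subseteq> T" "inseparable B" "w \<in> B" for B w
        using blocks[of B w] that sub \<open>T = S1 \<or> T = S2\<close> by blast
    qed (fact that)
    show ?thesis
    proof (cases "S1 \<inter> S2 = {}")
      case True
      obtain u where u: "u \<in> S2" using S by blast
      have "loses q s S2" using R[of S2 u] u assms(3) by (intro rooted_loses_imp_loses) auto
      then show ?thesis using rooted_loses_glue_disjoint[OF S(2) True S(6)] R[of S1 v] S by simp
    next
      case False
      with S(3) fin obtain w where w: "S1 \<inter> S2 = {w}"
        by (metis card_0_eq card_1_singletonE finite_Int le_neq_implies_less less_one)
      then have "w \<in> S2" by blast
      then show ?thesis
        using rooted_loses_glue_root[OF S(2), of v] rooted_loses_glue_away[OF S(2) w S(6)]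
          R[of S1 v] R[of S2 w] S(1,6) w by (cases "v = w") auto
    qed
  qed
qed

subsection \<open>Paths and cycles in blocks\<close>

definition path :: "'a set \<Rightarrow> 'a list \<Rightarrow> bool" where
  "path S xs \<longleftrightarrow> xs \<noteq> [] \<and> distinct xs \<and> set xs \<subseteq> S \<and> successively E xs"

text \<open>The first vertex is not repeated at the end, so the length of the list is also the
  number of edges.\<close>

definition cycle :: "'a set \<Rightarrow> 'a list \<Rightarrow> bool" where
  "cycle S xs \<longleftrightarrow> distinct xs \<and> set xs \<subseteq> S \<and> successively E xs \<and> 3 \<le> length xs \<and> E (last xs) (hd xs)"

definition reach :: "'a set \<Rightarrow> 'a \<Rightarrow> 'a \<Rightarrow> bool" where
  "reach S x y \<longleftrightarrow> (\<exists>xs. path S xs \<and> hd xs = x \<and> last xs = y)"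

section \<open>Reachability along paths\<close>

lemma E_commute: "E x y \<longleftrightarrow> E y x"
  using sym by blast

lemma successively_E_converse [simp]: "successively (\<lambda>x y. E y x) xs \<longleftrightarrow> successively E xs"
proof -
  have "(\<lambda>x y. E y x) = E" using sym by blast
  then show ?thesis by (rule arg_cong[of _ _ "\<lambda>f. successively f xs"])
qed

lemma path_rev [simp]: "path S (rev xs) \<longleftrightarrow> path S xs"
  by (simp add: path_def)

lemma path_prefix: "path S (xs @ ys) \<Longrightarrow> xs \<noteq> [] \<Longrightarrow> path S xs"
  by (auto simp: path_def successively_append_iff)

lemma path_suffix: "path S (xs @ ys) \<Longrightarrow> ys \<noteq> [] \<Longrightarrow> path S ys"
  by (auto simp: path_def successively_append_iff)

lemma path_prefix_upto:
  assumes "path S (xs @ y # ys)"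
  shows "path S (xs @ [y])" "hd (xs @ [y]) = hd (xs @ y # ys)"
  using assms path_prefix[of S "xs @ [y]" ys] by (simp, cases xs) simp_all

lemma path_mono: "path S xs \<Longrightarrow> S \<subseteq> T \<Longrightarrow> path T xs"
  by (auto simp: path_def)

lemma reach_refl: "x \<in> S \<Longrightarrow> reach S x x"
  unfolding reach_def by (intro exI[of _ "[x]"]) (simp add: path_def)

lemma reach_mem: "reach S x y \<Longrightarrow> x \<in> S \<and> y \<in> S"
  unfolding reach_def path_def by (auto dest: hd_in_set last_in_set)

lemma reach_sym: "reach S x y \<Longrightarrow> reach S y x"
  unfolding reach_def by (metis path_rev hd_rev last_rev)

text \<open>Appending \<open>z\<close> to the path may repeat a vertex; in that case the path is cut
  at its earlier visit to \<open>z\<close>.\<close>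

lemma reach_step:
  assumes "reach S x y" "E y z" "z \<in> S"
  shows "reach S x z"
proof -
  from assms(1) obtain xs where xs: "path S xs" "hd xs = x" "last xs = y"
    unfolding reach_def by blast
  show ?thesis
  proof (cases "z \<in> set xs")
    case True
    then obtain ys zs where ys: "xs = ys @ z # zs" by (auto dest: split_list)
    from xs path_prefix_upto[OF xs(1)[unfolded ys]] show ?thesis
      unfolding reach_def ys by (intro exI[of _ "ys @ [z]"]) simp
  next
    case False
    with xs assms(2,3) show ?thesis
      unfolding reach_def
      by (intro exI[of _ "xs @ [z]"]) (auto simp: path_def successively_append_iff)
  qed
qed

lemma reach_walk:
  "zs \<noteq> [] \<Longrightarrow> successively E zs \<Longrightarrow> set zs \<subseteq> S \<Longrightarrow> reach S x (hd zs) \<Longrightarrow> reach S x (last zs)"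
proof (induction zs)
  case (Cons a zs)
  show ?case
  proof (cases "zs = []")
    case False
    have "reach S x (hd zs)"
      by (rule reach_step[of S x a]) (use Cons.prems False in \<open>auto simp: successively_Cons\<close>)
    then show ?thesis using Cons False by (auto simp: successively_Cons)
  qed (use Cons in simp)
qed simp

lemma reach_trans:
  assumes "reach S x y" "reach S y z"
  shows "reach S x z"
proof -
  from assms(2) obtain zs where "path S zs" "hd zs = y" "last zs = z"
    unfolding reach_def by blast
  with assms(1) reach_walk[of zs S x] show ?thesis by (simp add: path_def)
qed

text \<open>Every vertex of a path from \<open>x\<close> ends a prefix of it and is thus reachable
  from \<open>x\<close> too, so such paths never leave the component.\<close>

lemma reach_component:
  assumes "reach S x y" "reach S x z"
  shows "reach {y. reach S x y} y z"
proof -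
  have comp: "reach {y. reach S x y} x u" if "reach S x u" for u
  proof -
    from that obtain xs where xs: "path S xs" "hd xs = x" "last xs = u"
      unfolding reach_def by blast
    have "set xs \<subseteq> {y. reach S x y}"
    proof
      fix w assume "w \<in> set xs"
      then obtain ys zs where ys: "xs = ys @ w # zs" by (auto dest: split_list)
      from xs(2) path_prefix_upto[OF xs(1)[unfolded ys]]
      have "reach S x w" unfolding reach_def ys by (intro exI[of _ "ys @ [w]"]) simp
      then show "w \<in> {y. reach S x y}" by simp
    qed
    with xs(1) have "path {y. reach S x y} xs" by (simp add: path_def)
    with xs(2,3) show ?thesis unfolding reach_def[of _ x u] by blast
  qed
  show ?thesis by (rule reach_trans[OF reach_sym[OF comp[OF assms(1)]] comp[OF assms(2)]])
qed

text \<open>The set \<open>C\<close> of vertices reachable from \<open>x\<close> yields a separation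
  into \<open>C\<close> together with \<open>W\<close>, and \<open>S - C\<close>, whose separator
  lies in \<open>W\<close>. Taking \<open>W\<close> empty gives connectivity, and taking a singleton
  gives connectivity after deleting a vertex.\<close>

lemma inseparable_reach:
  assumes S: "inseparable S" and W: "W \<subseteq> {w}" and xy: "x \<in> S - W" "y \<in> S - W"
  shows "reach (S - W) x y"
proof (rule ccontr)
  assume nr: "\<not> reach (S - W) x y"
  define C where "C = {z. reach (S - W) x z}"
  have C: "C \<subseteq> S - W" "x \<in> C" "y \<notin> C"
    using nr reach_mem[of "S - W" x] reach_refl[OF xy(1)] by (auto simp: C_def)
  have "separation (C \<union> (S \<inter> W)) (S - C)"
    unfolding separation_def
  proof (intro ballI notI)
    fix a b assume a: "a \<in> C \<union> S \<inter> W - (S - C)" and b: "b \<in> S - C - (C \<union> S \<inter> W)" and "E a b"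
    then have "reach (S - W) x a" "b \<in> S - W" by (auto simp: C_def)
    with \<open>E a b\<close> have "reach (S - W) x b" by (intro reach_step[of _ x a b])
    with b show False by (auto simp: C_def)
  qed
  moreover have "C \<union> (S \<inter> W) \<union> (S - C) = S" using C(1) by blast
  moreover have "card ((C \<union> (S \<inter> W)) \<inter> (S - C)) \<le> card {w}" using W by (intro card_mono) auto
  ultimately have "C \<union> (S \<inter> W) = S \<or> S - C = S"
    using S unfolding inseparable_def by simp
  with C xy show False by blast
qed

section \<open>Cycles through two given vertices of a block\<close>

lemma cycle_rotate: "cycle S (xs @ ys) \<Longrightarrow> cycle S (ys @ xs)"
  by (cases "xs = []"; cases "ys = []") (auto simp: cycle_def successively_append_iff)

lemma cycle_start:
  assumes "cycle S C" "x \<in> set C"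
  obtains ys where "cycle S (x # ys)" "set (x # ys) = set C" "length (x # ys) = length C"
proof -
  obtain as bs where C: "C = as @ x # bs" using assms(2) by (auto dest: split_list)
  with cycle_rotate[of S as "x # bs"] assms(1) have "cycle S (x # bs @ as)" by simp
  then show ?thesis by (rule that) (auto simp: C)
qed

lemma cycle_rev_tail:
  assumes "cycle S (x # ys)"
  shows "cycle S (x # rev ys)"
proof -
  have "ys \<noteq> []" using assms by (auto simp: cycle_def)
  then have "cycle S (rev ys @ [x])"
    using assms by (auto simp: cycle_def successively_append_iff successively_Cons hd_rev last_rev E_commute)
  from cycle_rotate[OF this] show ?thesis by simp
qed

text \<open>A path from \<open>x\<close> to a third vertex that avoids \<open>y\<close> starts with
  another neighbor of \<open>x\<close>. A path from this neighbor to \<open>y\<close> that avoids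
  \<open>x\<close> then closes up through \<open>x\<close>.\<close>

lemma cycle_through_edge:
  assumes S: "inseparable S" "finite S" "3 \<le> card S" and xy: "x \<in> S" "y \<in> S" "E x y"
  obtains C where "cycle S C" "x \<in> set C" "y \<in> set C"
proof -
  have neq: "x \<noteq> y" using xy irrefl by blast
  have "\<not> S \<subseteq> {x, y}"
  proof
    assume "S \<subseteq> {x, y}"
    then have "card S \<le> card {x, y}" by (intro card_mono) auto
    with S(3) neq show False by simp
  qed
  then obtain z where z: "z \<in> S" "z \<noteq> x" "z \<noteq> y" by blast
  have "reach (S - {y}) x z" using inseparable_reach[OF S(1) subset_refl] xy z neq by blast
  then obtain xs where xs: "path (S - {y}) xs" "hd xs = x" "last xs = z"
    unfolding reach_def by blast
  then obtain us where "xs = x # us" by (cases xs) (auto simp: path_def)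
  with xs z have us: "us \<noteq> []" "E x (hd us)" "x \<notin> set us" "set us \<subseteq> S - {y}"
    by (auto simp: path_def successively_Cons split: if_splits)
  let ?u = "hd us"
  have u: "?u \<in> S" "?u \<noteq> y" "?u \<noteq> x" using us(3,4) hd_in_set[OF us(1)] by blast+
  have "reach (S - {x}) ?u y" using inseparable_reach[OF S(1) subset_refl] u xy neq by blast
  then obtain zs where zs: "path (S - {x}) zs" "hd zs = ?u" "last zs = y"
    unfolding reach_def by blast
  obtain z1 zs' where zs': "zs = z1 # zs'" using zs(1) by (cases zs) (auto simp: path_def)
  with zs u(2) have "zs' \<noteq> []" by auto
  then have "2 \<le> length zs" by (cases zs') (auto simp: zs')
  with zs us xy have "cycle S (x # zs)" "y \<in> set zs"
    by (auto simp: cycle_def path_def successively_Cons E_commute)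
  then show ?thesis by (intro that[of "x # zs"]) auto
qed

text \<open>A path from \<open>y\<close> to \<open>x\<close> that avoids \<open>y'\<close> first
  meets the cycle in some \<open>z\<close>. The arc from \<open>y'\<close> to \<open>z\<close> that
  contains \<open>x\<close>, the path from \<open>z\<close> back to \<open>y\<close>, and the edge
  from \<open>y\<close> to \<open>y'\<close> form the new cycle.\<close>

lemma cycle_extend:
  assumes S: "inseparable S" and C: "cycle S C" "x \<in> set C" "y' \<in> set C" "x \<noteq> y'"
    and y: "E y' y" "y \<in> S"
  obtains D where "cycle S D" "x \<in> set D" "y \<in> set D"
proof (cases "y \<in> set C")
  case True
  with that C show ?thesis by blast
next
  case False
  have inS: "set C \<subseteq> S" using C(1) by (simp add: cycle_def)
  have "y \<noteq> y'" using y irrefl by blast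
  then have "reach (S - {y'}) y x" using inseparable_reach[OF S subset_refl] y C inS by blast
  then obtain R where R: "path (S - {y'}) R" "hd R = y" "last R = x"
    unfolding reach_def by blast
  then have "\<exists>z\<in>set R. z \<in> set C" using C(2) last_in_set[of R] by (auto simp: path_def)
  then obtain R1 z R2 where R': "R = R1 @ z # R2" "z \<in> set C" "set R1 \<inter> set C = {}"
    by (auto dest!: split_list_first_prop)
  have R1: "R1 \<noteq> []" using R' R(2) False by auto
  have hR1: "hd R1 = y" using R' R(2) R1 by simp
  have P: "distinct R1" "set R1 \<subseteq> S" "successively E R1" "E (last R1) z" "y' \<notin> set R1" "z \<noteq> y'"
    using R(1) R' R1 by (auto simp: path_def successively_append_iff)
  have new: "cycle S (y' # A @ z # rev R1)"
    if "cycle S (y' # A @ z # B)" "set (y' # A @ z # B) = set C" for A B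
  proof -
    have "set A \<inter> set R1 = {}" "z \<notin> set R1" using that(2) R'(3) by auto
    with that(1) P R1 hR1 y show ?thesis
      by (cases "A = []") (auto simp: cycle_def successively_append_iff successively_Cons hd_rev last_rev E_commute Suc_le_eq)
  qed
  from C(1,3) obtain cs where cs: "cycle S (y' # cs)" "set (y' # cs) = set C"
    by (rule cycle_start)
  then have "z \<in> set cs" using R'(2) P(6) by auto
  then obtain A B where AB: "cs = A @ z # B" by (auto dest: split_list)
  have yR: "y \<in> set R1" using R1 hR1 by auto
  \<comment> \<open>If \<open>x\<close> lies on the arc \<open>B\<close> instead of
    \<open>A\<close>, the cycle is traversed in the opposite direction, which exchanges the two
    arcs.\<close>
  show ?thesis
  proof (cases "x \<in> set A \<or> x = z")
    case True
    with new[of A B] cs AB yR show ?thesis by (intro that[of "y' # A @ z # rev R1"]) auto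
  next
    case False
    then have "x \<in> set B" using cs AB C by auto
    moreover have "cycle S (y' # rev B @ z # rev A)" using cycle_rev_tail[OF cs(1)] AB by simp
    ultimately show ?thesis using new[of "rev B" "rev A"] cs AB yR
      by (intro that[of "y' # rev B @ z # rev R1"]) auto
  qed
qed

text \<open>Induction along a path from \<open>x\<close>: each new edge moves the second vertex one
  step further while the cycle still contains \<open>x\<close>.\<close>

lemma cycle_through_two:
  assumes S: "inseparable S" "finite S" "3 \<le> card S"
  shows "zs \<noteq> [] \<Longrightarrow> path S (x # zs) \<Longrightarrow> \<exists>C. cycle S C \<and> x \<in> set C \<and> last zs \<in> set C"
proof (induction zs rule: rev_nonempty_induct)
  case (single y)
  then show ?case using cycle_through_edge[OF S, of x y] by (auto simp: path_def)
next
  case (snoc y zs)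
  have "path S (x # zs)" using snoc.prems path_prefix[of S "x # zs" "[y]"] by simp
  with snoc.IH obtain C where C: "cycle S C" "x \<in> set C" "last zs \<in> set C" by blast
  have "x \<noteq> last zs" "E (last zs) y" "y \<in> S"
    using snoc.prems snoc.hyps last_in_set[of zs] by (auto simp: path_def successively_append_iff successively_Cons)
  from cycle_extend[OF S(1) C this] show ?case by (metis last_snoc)
qed

text \<open>Both arcs of the cycle are paths from \<open>x\<close> to \<open>y\<close>. Here
  \<open>n\<close> counts vertices, and the two arcs together count the ends \<open>x\<close> and
  \<open>y\<close> twice, hence the summand 2.\<close>

lemma cycle_length_ge_distance:
  assumes C: "cycle S C" "x \<in> set C" "y \<in> set C" "x \<noteq> y"
    and n: "\<And>P. path S P \<Longrightarrow> hd P = x \<Longrightarrow> last P = y \<Longrightarrow> n \<le> length P"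
  shows "2 * n \<le> length C + 2"
proof -
  from C(1,2) obtain cs where cs: "cycle S (x # cs)" "set (x # cs) = set C" "length (x # cs) = length C"
    by (rule cycle_start)
  then have "y \<in> set cs" using C by auto
  then obtain A B where AB: "cs = A @ y # B" by (auto dest: split_list)
  have half: "n \<le> length A + 2" if "cycle S (x # A @ y # B)" for A B
    using that n[of "x # A @ [y]"]
    by (cases "A = []") (auto simp: cycle_def path_def successively_append_iff successively_Cons)
  have "cycle S (x # rev B @ y # rev A)" using cycle_rev_tail[OF cs(1)] AB by simp
  from half[OF this] half[of A B] cs AB show ?thesis by simp
qed

text \<open>
  Each stretch of \<open>Q\<close> outside \<open>P\<close> closes a cycle with the part of \<open>P\<close> that it skips, so it
  advances by less than \<open>c\<close> along \<open>P\<close>.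
\<close>

lemma path_progress:
  assumes P: "path S P" and c: "\<And>C. cycle S C \<Longrightarrow> length C \<le> c" "3 \<le> c"
  shows "path S Q \<Longrightarrow> hd Q = hd P \<Longrightarrow> last Q = P ! j \<Longrightarrow> j < length P \<Longrightarrow>
    j \<le> (length Q - 1) * (c - 1)"
proof (induction "length Q" arbitrary: Q j rule: less_induct)
  case less
  have dP: "distinct P" and neP: "P \<noteq> []" using P by (auto simp: path_def)
  have Qne: "Q \<noteq> []" using less.prems by (simp add: path_def)
  define Q0 where "Q0 = butlast Q"
  have Q: "Q = Q0 @ [P ! j]" using Qne less.prems(3) append_butlast_last_id[of Q] by (simp add: Q0_def)
  show ?case
  proof (cases "Q0 = []")
    case True
    with Q less.prems(2) have "P ! j = P ! 0" using neP by (simp add: hd_conv_nth)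
    then have "j = 0" using dP less.prems(4) neP nth_eq_iff_index_eq by blast
    then show ?thesis by simp
  next
    case False
    then have "hd Q0 = hd P" using Q less.prems(2) by simp
    then have "\<exists>z\<in>set Q0. z \<in> set P" using False neP by (metis hd_in_set)
    \<comment> \<open>The last visit of \<open>Q\<close> to \<open>P\<close> before its end is at
      \<open>z\<close>. The induction hypothesis applies up to \<open>z\<close>, and the remaining
      stretch \<open>zs\<close> avoids \<open>P\<close>.\<close>
    then obtain ys z zs where Q0: "Q0 = ys @ z # zs" "z \<in> set P" "\<forall>u\<in>set zs. u \<notin> set P"
      by (auto dest!: split_list_last_prop)
    then obtain i where i: "i < length P" "z = P ! i" by (metis in_set_conv_nth)
    have "Q = ys @ z # (zs @ [P ! j])" using Q Q0 by simp
    with less.prems(1,2) path_prefix_upto[of S ys z "zs @ [P ! j]"]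
    have "path S (ys @ [z])" "hd (ys @ [z]) = hd P" by simp_all
    from less.hyps[OF _ this, of i] i have IH: "i \<le> length ys * (c - 1)"
      using Q Q0 by simp
    have len: "length Q = Suc (length ys + Suc (length zs))" using Q Q0 by simp
    \<comment> \<open>The subtraction is truncated, so moving backward along \<open>P\<close> costs
      nothing. An advance by one need not create a cycle and is covered by the lower bound on
      \<open>c\<close>.\<close>
    have jump: "j - i \<le> c - 1"
    proof (cases "j \<le> Suc i")
      case True
      then show ?thesis using c(2) by linarith
    next
      case False
      define M where "M = take (Suc (j - i)) (drop i P)"
      have M: "length M = Suc (j - i)" "hd M = P ! i" "last M = P ! j"
        using False less.prems(4) i
        by (auto simp: M_def hd_conv_nth last_conv_nth)
      have PM: "P = take i P @ M @ drop (Suc (j - i)) (drop i P)"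
        unfolding M_def by (simp only: append_take_drop_id)
      have Mne: "M \<noteq> []" using M(1) by auto
      have pM: "path S M"
        using P PM Mne path_suffix[of S "take i P" "M @ drop (Suc (j - i)) (drop i P)"] path_prefix[of S M]
        by simp
      have MP: "set M \<subseteq> set P" using PM by (metis Un_iff set_append subsetI)
      have pz: "path S (z # zs @ [P ! j])"
        using less.prems(1) Q Q0 path_suffix[of S ys "z # zs @ [P ! j]"] by simp
      \<comment> \<open>The segment \<open>M\<close> has \<open>j - i + 1\<close> vertices, so a
        cycle containing it bounds \<open>j - i\<close> by \<open>c - 1\<close>.\<close>
      have "cycle S (M @ rev zs)"
        using pM pz Q0(3) MP M Mne i False
        by (cases "zs = []")
          (auto simp: cycle_def path_def successively_append_iff successively_Cons hd_rev last_rev E_commute)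
      from c(1)[OF this] M(1) show ?thesis by simp
    qed
    have "j \<le> i + (j - i)" by simp
    also have "\<dots> \<le> length ys * (c - 1) + (c - 1)" using IH jump by (rule add_mono)
    also have "\<dots> \<le> (length Q - 1) * (c - 1)" using len by (simp add: algebra_simps)
    finally show ?thesis .
  qed
qed

lemma inseparable_path_length:
  assumes S: "inseparable S" "finite S" and c: "\<And>C. cycle S C \<Longrightarrow> length C \<le> c"
    and d: "1 \<le> d" "c * (c - 1) \<le> 2 * d" and P: "path S (v # xs)"
  shows "length xs \<le> d"
\<comment> \<open>With fewer than three vertices there is no cycle to use, but a path then has at
  most one edge, and \<open>d\<close> is at least 1.\<close>
proof (cases "card S < 3 \<or> xs = []")
  case True
  have "length (v # xs) \<le> card S"
    using P S(2) card_mono[of S "set (v # xs)"] distinct_card[of "v # xs"] by (auto simp: path_def)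
  with True d(1) show ?thesis by auto
next
  case False
  then have S3: "3 \<le> card S" and xs: "xs \<noteq> []" by auto
  let ?y = "last xs"
  have vy: "v \<noteq> ?y" using P xs last_in_set[OF xs] by (auto simp: path_def)
  obtain C where C: "cycle S C" "v \<in> set C" "?y \<in> set C"
    using cycle_through_two[OF S S3 xs P] by blast
  have c3: "3 \<le> c" using c[OF C(1)] C(1) by (simp add: cycle_def)
  obtain Q where Q: "path S Q \<and> hd Q = v \<and> last Q = ?y"
    and min: "\<And>R. path S R \<and> hd R = v \<and> last R = ?y \<Longrightarrow> length Q \<le> length R"
    using ex_has_least_nat[of "\<lambda>Q. path S Q \<and> hd Q = v \<and> last Q = ?y" "v # xs" length] P xs by auto
  have "2 * length Q \<le> length C + 2"
    using min by (intro cycle_length_ge_distance[OF C vy]) blast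
  with c[OF C(1)] have Q2: "2 * (length Q - 1) \<le> c" by linarith
  have "length xs \<le> (length Q - 1) * (c - 1)"
    using Q xs by (intro path_progress[OF P c c3]) (auto simp: last_conv_nth)
  then have "2 * length xs \<le> (2 * (length Q - 1)) * (c - 1)" by simp
  also have "\<dots> \<le> c * (c - 1)" using Q2 by (rule mult_le_mono1)
  finally show ?thesis using d(2) by linarith
qed

subsection \<open>Blocks with bounded cycles\<close>

text \<open>No edge leaves a component, so escaping colorings of the components can be chosen
  independently and patched together.\<close>

lemma loses_if_components:
  assumes "1 \<le> q" and comp: "\<And>x. x \<in> K \<Longrightarrow> loses q s {y. reach K x y}"
  shows "loses q s K"
  unfolding loses_def
proof (intro allI impI)
  fix \<Gamma> assume \<Gamma>: "strategy s K \<Gamma>"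
  define C where "C x = {y. reach K x y}" for x
  have "\<exists>\<phi>. range \<phi> \<subseteq> {1..q} \<and> (\<forall>v\<in>D. \<phi> v \<notin> \<Gamma> v \<phi>)" if "D \<in> C ` K" for D
  proof -
    from that obtain x where x: "x \<in> K" "D = C x" by blast
    have "D \<subseteq> K" using reach_mem[of K x] by (auto simp: C_def x(2))
    moreover have "w \<in> D" if "v \<in> D" "w \<in> K" "E v w" for v w
      using that reach_step[of K x v w] by (auto simp: C_def x(2))
    ultimately have "strategy s D \<Gamma>" by (rule strategy_subset[OF \<Gamma>])
    then show ?thesis using comp[OF x(1)] by (metis losesE C_def x(2))
  qed
  then obtain F where F: "\<And>D. D \<in> C ` K \<Longrightarrow> range (F D) \<subseteq> {1..q}"
    "\<And>D v. D \<in> C ` K \<Longrightarrow> v \<in> D \<Longrightarrow> F D v \<notin> \<Gamma> v (F D)"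
    by metis
  \<comment> \<open>The value 1 outside \<open>K\<close> only keeps the range among the
    colors.\<close>
  define \<phi> where "\<phi> z = (if z \<in> K then F (C z) z else 1)" for z
  have "\<phi> z \<in> {1..q}" for z
    using range_subsetD[OF F(1)[of "C z"], of z] \<open>1 \<le> q\<close> by (simp add: \<phi>_def)
  then have "range \<phi> \<subseteq> {1..q}" by blast
  moreover have "\<phi> v \<notin> \<Gamma> v \<phi>" if v: "v \<in> K" for v
  proof -
    have "\<phi> w = F (C v) w" if w: "w \<in> K" "E v w" for w
    proof -
      have "reach K v w" by (rule reach_step[OF reach_refl[OF v] w(2,1)])
      then have "C w = C v" unfolding C_def using reach_trans reach_sym by blast
      with w show ?thesis by (simp add: \<phi>_def)
    qed
    then have "\<Gamma> v \<phi> = \<Gamma> v (F (C v))" by (rule strategy_cong[OF \<Gamma> v])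
    moreover have "v \<in> C v" using reach_refl[OF v] by (simp add: C_def)
    ultimately show ?thesis using F(2)[of "C v" v] v by (simp add: \<phi>_def)
  qed
  ultimately show "\<exists>\<phi>. range \<phi> \<subseteq> {1..q} \<and> (\<forall>v\<in>K. \<phi> v \<notin> \<Gamma> v \<phi>)" by blast
qed

text \<open>
  Depth-first search: every component of \<open>K\<close> contains a neighbor \<open>u\<close> of \<open>v\<close>, and removing \<open>u\<close>
  shortens the paths that start there.
\<close>

lemma loses_if_paths_bounded:
  assumes q: "sylvester n < q"
  shows "k + d \<le> Suc n \<Longrightarrow> v \<notin> K \<Longrightarrow> (\<And>x. x \<in> K \<Longrightarrow> reach (insert v K) v x) \<Longrightarrow>
    (\<And>xs. path (insert v K) (v # xs) \<Longrightarrow> length xs \<le> d) \<Longrightarrow> loses q (sylvester k) K"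
proof (induction d arbitrary: k v K)
  case 0
  have "K = {}"
  proof (rule ccontr)
    assume "K \<noteq> {}"
    then obtain x where x: "x \<in> K" by blast
    from 0(3)[OF x] obtain xs where xs: "path (insert v K) xs" "hd xs = v" "last xs = x"
      unfolding reach_def by blast
    then obtain ys where "xs = v # ys" by (cases xs) (auto simp: path_def)
    with xs 0(4)[of ys] x 0(2) show False by auto
  qed
  then show ?case using q loses_empty by simp
next
  case (Suc d)
  show ?case
  proof (rule loses_if_components)
    show "1 \<le> q" using q by simp
    fix x assume x: "x \<in> K"
    define C where "C = {y. reach K x y}"
    have CK: "C \<subseteq> K" using reach_mem[of K x] by (auto simp: C_def)
    from Suc.prems(3)[OF x] obtain xs where xs: "path (insert v K) xs" "hd xs = v" "last xs = x"
      unfolding reach_def by blast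
    then obtain ys where ys: "xs = v # ys" by (cases xs) (auto simp: path_def)
    with xs x Suc.prems(2) have ne: "ys \<noteq> []" by auto
    \<comment> \<open>The rest of the path after \<open>v\<close> stays in \<open>K\<close>, so
      \<open>u\<close> is a neighbor of \<open>v\<close> in the component of
      \<open>x\<close>.\<close>
    define u where "u = hd ys"
    have Evu: "E v u" and pK: "path K ys"
      using xs(1) ne by (auto simp: ys u_def path_def successively_Cons)
    have "reach K u x" unfolding reach_def using pK xs(3) ne by (auto simp: ys u_def)
    then have u: "u \<in> C" by (auto simp: C_def intro: reach_sym)
    have iC: "insert u (C - {u}) = C" using u by blast
    have "loses q (sylvester (Suc k)) (C - {u})"
    proof (rule Suc.IH[of _ u], unfold iC)
      show "Suc k + d \<le> Suc n" using Suc.prems(1) by simp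
      show "reach C u y" if "y \<in> C - {u}" for y
        using reach_component[of K x u y] u that by (simp add: C_def)
      fix zs assume "path C (u # zs)"
      then have "path K (u # zs)" by (rule path_mono[OF _ CK])
      then have "path (insert v K) (v # u # zs)"
        using Suc.prems(2) Evu by (auto simp: path_def)
      from Suc.prems(4)[OF this] show "length zs \<le> d" by simp
    qed simp
    \<comment> \<open>As \<open>k\<close> grows by one whenever the path bound drops by one, a
      vertex is removed only while \<open>k\<close> is at most \<open>n\<close>. The index
      \<open>Suc n\<close> can occur only once \<open>K\<close> is empty.\<close>
    moreover have "sylvester k < q" using sylvester_mono[of k n] Suc.prems(1) q by simp
    ultimately show "loses q (sylvester k) {y. reach K x y}"
      using loses_remove_vertex[of q "sylvester k" C u] u by (simp add: C_def)
  qed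
qed

text \<open>Removing the root turns one guess into \<open>1 * 2 = sylvester 1\<close> guesses, and
  the depth-first search continues from \<open>v\<close> in the connected block.\<close>

lemma rooted_loses_inseparable:
  assumes S: "inseparable S" "finite S" and c: "\<And>C. cycle S C \<Longrightarrow> length C \<le> c"
    and d: "1 \<le> d" "c * (c - 1) \<le> 2 * d" and q: "sylvester d < q" and v: "v \<in> S"
  shows "rooted_loses q 1 S v"
proof (rule rooted_loses_remove_vertex)
  have iS: "insert v (S - {v}) = S" using v by blast
  have "loses q (sylvester 1) (S - {v})"
  proof (rule loses_if_paths_bounded[OF q, of 1 d v], unfold iS)
    show "reach S v x" if "x \<in> S - {v}" for x
      using inseparable_reach[OF S(1) empty_subsetI, of v x] v that by simp
    show "length xs \<le> d" if "path S (v # xs)" for xs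
      using inseparable_path_length[OF S c d that] .
  qed simp_all
  then show "loses q (1 * Suc 1) (S - {v})" by simp
qed

lemma loses_bounded_cycles:
  assumes S: "finite S" and c: "\<And>C. cycle S C \<Longrightarrow> length C \<le> c"
    and d: "1 \<le> d" "c * (c - 1) \<le> 2 * d" and q: "sylvester d < q"
  shows "loses q 1 S"
proof (cases "S = {}")
  case True
  then show ?thesis using q loses_empty by simp
next
  case False
  then obtain v where v: "v \<in> S" by blast
  have q1: "1 < q" using sylvester_mono[OF d(1)] q by simp
  have "rooted_loses q 1 S v"
  proof (rule rooted_loses_if_blocks[OF S v q1])
    fix B u assume B: "B \<subseteq> S" "inseparable B" "u \<in> B"
    have "length C \<le> c" if "cycle B C" for C
      using that B(1) by (intro c) (auto simp: cycle_def)
    then show "rooted_loses q 1 B u"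
      using B S finite_subset by (intro rooted_loses_inseparable[OF _ _ _ d q]) auto
  qed
  then show ?thesis using v q1 by (rule rooted_loses_imp_loses)
qed

end

section \<open>Hat guessing numbers\<close>

lemma (in graph) simple_graph_adj: "simple_graph (\<lambda>u v. u \<rightarrow>\<^bsub>G\<^esub> v)"
  by unfold_locales (use arcs_ends_symmetric[OF sym_arcs] adj_not_same in auto)

lemma (in wf_digraph) awalk_of_vertex_list:
  "successively (\<lambda>u v. u \<rightarrow>\<^bsub>G\<^esub> v) (u # xs) \<Longrightarrow> u \<in> verts G \<Longrightarrow>
    \<exists>p. awalk u p (last (u # xs)) \<and> awalk_verts u p = u # xs"
proof (induction xs arbitrary: u)
  case Nil
  then show ?case by (intro exI[of _ "[]"]) (simp add: awalk_Nil_iff)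
next
  case (Cons w xs)
  then have "u \<rightarrow>\<^bsub>G\<^esub> w" by simp
  then obtain e where e: "e \<in> arcs G" "tail G e = u" "head G e = w"
    unfolding arcs_ends_conv by auto
  then have "w \<in> verts G" by auto
  with Cons obtain p where "awalk w p (last (w # xs))" "awalk_verts w p = w # xs" by auto
  with e show ?case by (intro exI[of _ "e # p"]) (simp add: awalk_Cons_iff)
qed

lemma (in graph) undirected_cycle_of_vertex_list:
  assumes "simple_graph.cycle (\<lambda>u v. u \<rightarrow>\<^bsub>G\<^esub> v) (verts G) xs"
  shows "\<exists>p. undirected_cycle G p \<and> length p = length xs"
proof -
  interpret sg: simple_graph "\<lambda>u v. u \<rightarrow>\<^bsub>G\<^esub> v" by (rule simple_graph_adj)
  obtain x ys where xs: "xs = x # ys" using assms by (cases xs) (auto simp: sg.cycle_def)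
  \<comment> \<open>Repeating the first vertex at the end makes the closed walk have as many arcs as
    the cycle has vertices.\<close>
  have "successively (\<lambda>u v. u \<rightarrow>\<^bsub>G\<^esub> v) (xs @ [x])"
    using assms by (subst successively_append_iff) (simp add: sg.cycle_def xs)
  then obtain p where p: "awalk x p x" "awalk_verts x p = x # ys @ [x]"
    using awalk_of_vertex_list[of x "ys @ [x]"] assms by (auto simp: sg.cycle_def xs)
  have len: "length p = length xs" using length_awalk_verts[of x p] p(2) by (simp add: xs)
  have "pre_digraph.cycle G p"
    unfolding cycle_def using p assms len by (intro exI[of _ x]) (auto simp: sg.cycle_def xs)
  with assms len show ?thesis by (auto simp: undirected_cycle_def sg.cycle_def)
qed

lemma (in graph) winning_strategy_not_loses:
  assumes win: "winning_strategy G q \<Gamma>"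
  shows "\<not> simple_graph.loses (\<lambda>u v. u \<rightarrow>\<^bsub>G\<^esub> v) q 1 (verts G)"
proof
  interpret sg: simple_graph "\<lambda>u v. u \<rightarrow>\<^bsub>G\<^esub> v" by (rule simple_graph_adj)
  \<comment> \<open>The ordinary game is the game with one guess, given as a singleton.\<close>
  define \<Gamma>' where "\<Gamma>' v \<phi> = {\<Gamma> v (restrict \<phi> (neighbors G v))}" for v \<phi>
  assume "sg.loses q 1 (verts G)"
  moreover have "sg.strategy 1 (verts G) \<Gamma>'"
  proof (rule sg.strategyI)
    fix v and \<phi> \<psi> :: "'a \<Rightarrow> nat"
    assume "\<And>w. w \<in> verts G \<Longrightarrow> v \<rightarrow>\<^bsub>G\<^esub> w \<Longrightarrow> \<phi> w = \<psi> w"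
    then have "restrict \<phi> (neighbors G v) = restrict \<psi> (neighbors G v)"
      by (intro restrict_ext) (simp add: neighbors_def)
    then show "\<Gamma>' v \<phi> = \<Gamma>' v \<psi>" by (simp add: \<Gamma>'_def)
  qed (simp_all add: \<Gamma>'_def)
  ultimately obtain \<phi> where \<phi>: "range \<phi> \<subseteq> {1..q}" "\<And>v. v \<in> verts G \<Longrightarrow> \<phi> v \<notin> \<Gamma>' v \<phi>"
    by (rule sg.losesE) blast
  have "restrict \<phi> (verts G) \<in> hat_assignments G q"
    using \<phi>(1) by (auto simp: hat_assignments_def)
  with win obtain v where v: "v \<in> verts G" "guesses_correctly G \<Gamma> (restrict \<phi> (verts G)) v"
    by (auto simp: winning_strategy_def)
  have "verts G \<inter> neighbors G v = neighbors G v" by (auto simp: neighbors_def)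
  with v \<phi>(2)[OF v(1)] show False by (simp add: guesses_correctly_def \<Gamma>'_def)
qed

lemma (in graph) hat_guessing_number_le_sylvester:
  assumes c: "\<And>p. undirected_cycle G p \<Longrightarrow> length p \<le> c"
    and d: "1 \<le> d" "c * (c - 1) \<le> 2 * d"
  shows "hat_guessing_number G \<le> sylvester d"
proof -
  interpret sg: simple_graph "\<lambda>u v. u \<rightarrow>\<^bsub>G\<^esub> v" by (rule simple_graph_adj)
  have "length C \<le> c" if "sg.cycle (verts G) C" for C
    using undirected_cycle_of_vertex_list[OF that] c by metis
  then have "q \<le> sylvester d" if "winning_strategy G q \<Gamma>" for q \<Gamma>
    using winning_strategy_not_loses[OF that] sg.loses_bounded_cycles[OF finite_verts _ d, of q]
    by (meson not_le)
  then have "q \<le> sylvester d" if "q \<in> {q. \<exists>\<Gamma>. winning_strategy G q \<Gamma>}" for q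
    using that by blast
  then show ?thesis
    unfolding hat_guessing_number_def
    \<comment> \<open>The supremum of the empty set is 0, which settles the case that no number of
      colors admits a winning strategy.\<close>
    by (cases "{q. \<exists>\<Gamma>. winning_strategy G q \<Gamma>} = {}") (simp add: Sup_nat_def, rule cSup_least)
qed

theorem theorem1p2:
  fixes G :: "('a, 'b) pre_digraph" and c :: int
  assumes "graph G"
    and "\<not> (\<exists>p. undirected_cycle G p \<and> int (length p) > c)"
  shows "real (hat_guessing_number G)
    < (64 / 25 :: real) powr ((2 :: real) powi (\<lfloor>(1 / 2 :: real) * (real_of_int c)\<^sup>2\<rfloor> - 1)) + 1 / 2"
proof -
  define n where "n = \<lfloor>(1 / 2 :: real) * (real_of_int c)\<^sup>2\<rfloor>"
  \<comment> \<open>This is the bound on the number of edges of a path in a block, raised to 1 to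
    cover blocks that consist of one edge. A negative \<open>c\<close> becomes 0 under
    \<open>nat\<close>.\<close>
  define d where "d = max 1 (nat c * (nat c - 1) div 2)"
  have "even (nat c * (nat c - 1))" by (cases "nat c") auto
  then have "nat c * (nat c - 1) = 2 * (nat c * (nat c - 1) div 2)" by simp
  then have d: "1 \<le> d" "nat c * (nat c - 1) \<le> 2 * d" unfolding d_def by linarith+
  have "length p \<le> nat c" if "undirected_cycle G p" for p
    using assms(2) that by (force simp: le_nat_iff)
  from graph.hat_guessing_number_le_sylvester[OF assms(1) this d]
  have le: "real (hat_guessing_number G) \<le> real (sylvester d)" by simp
  show ?thesis
  \<comment> \<open>Here the integer exponent is -1, so the right-hand side is
    \<open>8 / 5 + 1 / 2\<close>, just above \<open>sylvester 1 = 2\<close>.\<close>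
  proof (cases "\<bar>c\<bar> \<le> 1")
    case True
    then have c: "c = 0 \<or> c = 1 \<or> c = -1" by auto
    then have "d = 1" by (auto simp: d_def)
    moreover have "n = 0" using c by (auto simp: n_def floor_eq_iff)
    moreover have "sqrt (64 / 25) = 8 / 5" by (rule real_sqrt_unique) (simp_all add: power2_eq_square)
    ultimately have "(64 / 25 :: real) powr (2 powi (n - 1)) = 8 / 5" and "real (sylvester d) = 2"
      using powr_half_sqrt[of "64 / 25"] by (simp_all add: power_int_minus inverse_eq_divide)
    then show ?thesis using le unfolding n_def by linarith
  next
    case False
    \<comment> \<open>For \<open>c\<close> at least 3, the difference between the square of
      \<open>c\<close> and \<open>c * (c - 1)\<close> is \<open>c\<close>, which leaves room for the
      2. This absorbs the -1 in the exponent.\<close>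
    have "2 * (int d + 1) \<le> c\<^sup>2"
    proof (cases "c \<le> 2")
      case True
      then have "d = 1" using False by (cases "c = 2") (auto simp: d_def)
      moreover have "2 * 2 \<le> \<bar>c\<bar> * \<bar>c\<bar>" using False by (intro mult_mono) auto
      ultimately show ?thesis by (simp add: power2_eq_square)
    next
      case c: False
      define m where "m = nat c"
      have m: "c = int m" "3 \<le> m" using c by (auto simp: m_def)
      have "2 * 3 \<le> (m - 1) * m" using m(2) by (intro mult_le_mono) auto
      then have "d = m * (m - 1) div 2" using m(1) by (simp add: d_def mult.commute)
      then have "2 * d \<le> m * (m - 1)" by simp
      then have "2 * d + m \<le> m * m" using m(2) by (cases m) (auto simp: algebra_simps)
      then have "2 * d + 2 \<le> m * m" using m(2) by linarith
      then show ?thesis using m(1) by (simp add: power2_eq_square flip: of_nat_mult)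
    qed
    then have "2 * (real d + 1) \<le> (real_of_int c)\<^sup>2"
      by (metis (mono_tags, opaque_lifting) of_int_le_iff of_int_mult of_int_numeral of_int_add of_int_1 of_int_of_nat_eq of_int_power)
    then have "int d + 1 \<le> n" by (simp add: n_def le_floor_iff)
    then obtain m where m: "n - 1 = int m" "d \<le> m"
      by (metis add_le_imp_le_diff int_ops(1) nonneg_int_cases of_nat_0_le_iff of_nat_le_iff order_trans)
    have "(64 / 25 :: real) powr (2 powi (n - 1)) = (64 / 25) powr real (2 ^ m)"
      using m(1) by simp
    also have "\<dots> = (64 / 25) ^ 2 ^ m" by (rule powr_realpow) simp
    also have "\<dots> \<ge> (64 / 25) ^ 2 ^ d" using m(2) by (intro power_increasing) auto
    finally show ?thesis using le sylvester_bound[of d] unfolding n_def by linarith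
  qed
qed

end
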